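(* Let $n,a,b$ be natural numbers with $n\ge a+b$. If $u$ and $v$ are binary words of lengths $n-a$ and $n-b$ respectively with $\mathrm{SCS}(u,v)=n$ (equivalently, $\mathrm{LCS}(u,v)=n-a-b$), then \[ m_{\mathsf{LCS}}(u,v)\le m_{\mathsf{SCS}}(u,v)\le\binom{a+b}{a}. \]
   Context: Words are finite strings over $\{0,1\}$. $w$ is a subsequence of $u$ (and $u$ a supersequence of $w$) if $w$ is obtained from $u$ by deleting some letters. $\mathrm{LCS}(u,v)$ is the maximum length of a common subsequence of $u,v$ and $\mathrm{SCS}(u,v)$ the minimum length of a common supersequence; an LCS (resp. SCS) is a common subsequence (resp. supersequence) of that length. $m_{\mathsf{LCS}}(u,v)$ (resp. $m_{\mathsf{SCS}}(u,v)$) is the number of distinct LCS's (resp. SCS's) of $u$ and $v$. *)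

theory Defs
  imports Complex_Main "HOL-Library.Sublist"
begin

type_synonym word = "bool list"

definition common_subseqs :: "word \<Rightarrow> word \<Rightarrow> word set" where
  "common_subseqs u v = {w. subseq w u \<and> subseq w v}"

definition common_superseqs :: "word \<Rightarrow> word \<Rightarrow> word set" where
  "common_superseqs u v = {w. subseq u w \<and> subseq v w}"

definition LCS :: "word \<Rightarrow> word \<Rightarrow> nat" where
  "LCS u v = Max (length ` common_subseqs u v)"

text \<open>The set of common supersequences is infinite, so the minimum is taken with
  \<open>LEAST\<close>; \<open>Min\<close> is only meaningful for finite sets.\<close>

definition SCS :: "word \<Rightarrow> word \<Rightarrow> nat" where
  "SCS u v = (LEAST k. k \<in> length ` common_superseqs u v)"

definition m_LCS :: "word \<Rightarrow> word \<Rightarrow> nat" where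
  "m_LCS u v = card {w \<in> common_subseqs u v. length w = LCS u v}"

definition m_SCS :: "word \<Rightarrow> word \<Rightarrow> nat" where
  "m_SCS u v = card {w \<in> common_superseqs u v. length w = SCS u v}"

end

theory Submission
  imports Defs
begin

text \<open>All counts are compared by recursion on the first letters. If \<open>u\<close> and \<open>v\<close> start with the
  same letter, every LCS and every SCS starts with it, and it can be stripped. If they start with
  different letters \<open>x\<close> and \<open>y\<close>, removing the first letter splits the SCS's of \<open>u\<close> and \<open>v\<close>
  disjointly into those of \<open>tl u\<close>, \<open>v\<close> and of \<open>u\<close>, \<open>tl v\<close>, which matches Pascal's rule; while an
  LCS of \<open>u\<close> and \<open>v\<close> cannot start with both \<open>x\<close> and \<open>y\<close>, so it is a common subsequence of
  one of these two pairs.\<close>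

text \<open>The length is a free parameter, not the optimum: after one letter is removed the smaller
  pair may have no word of that length, and its set is then just empty.\<close>

definition subseqs_len :: "nat \<Rightarrow> 'a list \<Rightarrow> 'a list \<Rightarrow> 'a list set" where
  "subseqs_len l u v = {w. subseq w u \<and> subseq w v \<and> length w = l}"

definition superseqs_len :: "nat \<Rightarrow> 'a list \<Rightarrow> 'a list \<Rightarrow> 'a list set" where
  "superseqs_len k u v = {w. subseq u w \<and> subseq v w \<and> length w = k}"

lemma finite_superseqs_len: "finite (superseqs_len k u (v :: 'a::finite list))"
  by (rule finite_subset[OF _ finite_lists_length_eq[of UNIV k]]) (auto simp: superseqs_len_def)

lemma finite_subseqs_len: "finite (subseqs_len l u v)"
  by (rule finite_subset[of _ "set (subseqs u)"]) (auto simp: subseqs_len_def)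

section \<open>Duality between the lengths of an LCS and an SCS\<close>

text \<open>Merge \<open>u\<close> and \<open>v\<close> along \<open>w\<close>, writing each letter
  of \<open>w\<close> once for both words.\<close>

lemma ex_superseq_of_subseq:
  assumes "subseq w u" "subseq w v"
  shows "\<exists>s. subseq u s \<and> subseq v s \<and> length s + length w = length u + length v"
  using assms
proof (induction "length u + length v" arbitrary: u v w rule: less_induct)
  case less
  show ?case
  proof (cases "u = [] \<or> v = []")
    case True
    then show ?thesis using less.prems by auto
  next
    case False
    then obtain x u' y v' where uv: "u = x # u'" "v = y # v'" by (meson neq_Nil_conv)
    \<comment> \<open>Either \<open>w\<close> avoids the first letter of one of the words, or it
      uses both first letters, which then coincide.\<close>
    have "subseq w u' \<or> subseq w v' \<or>
      (\<exists>w'. x = y \<and> w = x # w' \<and> subseq w' u' \<and> subseq w' v')"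
      using less.prems unfolding uv by (cases w) (auto split: if_splits)
    then consider "subseq w u'" | "subseq w v'"
      | w' where "x = y" "w = x # w'" "subseq w' u'" "subseq w' v'" by blast
    then show ?thesis
    proof cases
      case 1
      then obtain s where "subseq u' s" "subseq v s" "length s + length w = length u' + length v"
        using less.hyps[of u' v w] less.prems uv by auto
      then have "subseq u (x # s) \<and> subseq v (x # s) \<and> length (x # s) + length w = length u + length v"
        using uv by (auto intro: subseq_Cons')
      then show ?thesis by blast
    next
      case 2
      then obtain s where "subseq u s" "subseq v' s" "length s + length w = length u + length v'"
        using less.hyps[of u v' w] less.prems uv by auto
      then have "subseq u (y # s) \<and> subseq v (y # s) \<and> length (y # s) + length w = length u + length v"
        using uv by (auto intro: subseq_Cons')
      then show ?thesis by blast
    next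
      case 3
      then obtain s where "subseq u' s" "subseq v' s" "length s + length w' = length u' + length v'"
        using less.hyps[of u' v' w'] uv by auto
      then have "subseq u (x # s) \<and> subseq v (x # s) \<and> length (x # s) + length w = length u + length v"
        using uv 3 by auto
      then show ?thesis by blast
    qed
  qed
qed

text \<open>Keep the letters of \<open>s\<close> used by both embeddings, and count positions by
  inclusion-exclusion. Positions used by neither embedding make this an inequality.\<close>

lemma ex_subseq_of_superseq:
  assumes "subseq u s" "subseq v s"
  shows "\<exists>w. subseq w u \<and> subseq w v \<and> length u + length v \<le> length s + length w"
  using assms
proof (induction s arbitrary: u v rule: list.induct)
  case Nil
  then show ?case by auto
next
  case (Cons z s)
  have strip: "subseq (t :: 'a list) s \<or> (\<exists>t'. t = z # t' \<and> subseq t' s)" if "subseq t (z # s)" for t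
    using that by (cases t) (auto split: if_splits)
  show ?case
  proof (cases "subseq u s")
    case True
    \<comment> \<open>\<open>v'\<close> is \<open>v\<close> or its tail; the letter possibly lost is
      paid for by the extra letter \<open>z\<close>.\<close>
    obtain v' where v': "subseq v' s" "subseq v' v" "length v \<le> Suc (length v')"
      using strip[OF Cons.prems(2)] by fastforce
    from Cons.IH[OF True v'(1)] obtain w where
      "subseq w u" "subseq w v'" "length u + length v' \<le> length s + length w" by blast
    then show ?thesis using v' by (intro exI[of _ w]) (auto intro: subseq_order.trans)
  next
    case False
    then obtain u' where u': "u = z # u'" "subseq u' s" using strip[OF Cons.prems(1)] by blast
    from strip[OF Cons.prems(2)] show ?thesis
    proof (elim disjE exE conjE)
      assume "subseq v s"
      from Cons.IH[OF u'(2) this] obtain w where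
        "subseq w u'" "subseq w v" "length u' + length v \<le> length s + length w" by blast
      then show ?thesis using u' by (intro exI[of _ w]) auto
    next
      fix v' assume v: "v = z # v'" "subseq v' s"
      from Cons.IH[OF u'(2) v(2)] obtain w where
        "subseq w u'" "subseq w v'" "length u' + length v' \<le> length s + length w" by blast
      then show ?thesis using u' v by (intro exI[of _ "z # w"]) auto
    qed
  qed
qed

lemma finite_common_subseqs: "finite (common_subseqs u v)"
  by (rule finite_subset[of _ "set (subseqs u)"]) (auto simp: common_subseqs_def)

lemma length_le_LCS:
  assumes "subseq w u" "subseq w v"
  shows "length w \<le> LCS u v"
  unfolding LCS_def by (rule Max_ge) (use assms finite_common_subseqs in \<open>auto simp: common_subseqs_def\<close>)

lemma LCS_attained:
  obtains w where "subseq w u" "subseq w v" "length w = LCS u v"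
proof -
  have "[] \<in> common_subseqs u v" by (simp add: common_subseqs_def)
  then have "LCS u v \<in> length ` common_subseqs u v"
    unfolding LCS_def by (intro Max_in) (auto simp: finite_common_subseqs)
  then show thesis using that by (auto simp: common_subseqs_def)
qed

lemma SCS_le_length:
  assumes "subseq u w" "subseq v w"
  shows "SCS u v \<le> length w"
  unfolding SCS_def by (rule Least_le) (use assms in \<open>auto simp: common_superseqs_def\<close>)

lemma SCS_attained:
  obtains w where "subseq u w" "subseq v w" "length w = SCS u v"
proof -
  have "length (u @ v) \<in> length ` common_superseqs u v"
    by (auto simp: common_superseqs_def list_emb_append2 simp del: length_append)
  then have "SCS u v \<in> length ` common_superseqs u v"
    unfolding SCS_def by (rule LeastI)
  then show thesis using that by (auto simp: common_superseqs_def)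
qed

text \<open>Each inequality converts an optimal word of one kind into a word of the other
  kind.\<close>

lemma SCS_plus_LCS: "SCS u v + LCS u v = length u + length v"
proof (rule antisym)
  obtain w where w: "subseq w u" "subseq w v" "length w = LCS u v" by (rule LCS_attained)
  obtain s where "subseq u s" "subseq v s" "length s + length w = length u + length v"
    using ex_superseq_of_subseq[OF w(1,2)] by blast
  then show "SCS u v + LCS u v \<le> length u + length v"
    using SCS_le_length[of u s v] w by linarith
next
  obtain s where s: "subseq u s" "subseq v s" "length s = SCS u v" by (rule SCS_attained)
  obtain w where "subseq w u" "subseq w v" "length u + length v \<le> length s + length w"
    using ex_subseq_of_superseq[OF s(1,2)] by blast
  then show "length u + length v \<le> SCS u v + LCS u v"
    using length_le_LCS[of w u v] s by linarith
qed

section \<open>The binomial bound for supersequences\<close>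

lemma superseqs_len_length_fst: "superseqs_len (length u) u v \<subseteq> {u}"
  using subseq_same_length by (force simp: superseqs_len_def)

lemma superseqs_len_length_snd: "superseqs_len (length v) u v \<subseteq> {v}"
  using subseq_same_length by (force simp: superseqs_len_def)

text \<open>Here \<open>a\<close> and \<open>b\<close> count the letters that \<open>u\<close> and
  \<open>v\<close> fall short of \<open>k\<close>. Asking only that \<open>k\<close> be a lower
  bound for the lengths, rather than the minimum, lets the hypothesis pass to both smaller
  pairs.\<close>

lemma card_superseqs_len_le:
  assumes "length u + a = k" "length v + b = k"
    and "\<And>w. subseq u w \<Longrightarrow> subseq v w \<Longrightarrow> k \<le> length w"
  shows "card (superseqs_len k u v) \<le> (a + b) choose a"
  using assms
proof (induction k arbitrary: u v a b)
  case 0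
  have "card (superseqs_len 0 u v) \<le> card {u}"
    by (rule card_mono) (use 0 superseqs_len_length_fst[of u v] in auto)
  then show ?case using 0 by simp
next
  case (Suc k)
  consider "a = 0" | "b = 0" | "a > 0" "b > 0" by blast
  then show ?case
  proof cases
    case 1
    have "card (superseqs_len (Suc k) u v) \<le> card {u}"
      by (rule card_mono) (use 1 Suc.prems superseqs_len_length_fst[of u v] in auto)
    then show ?thesis using 1 by simp
  next
    case 2
    have "card (superseqs_len (Suc k) u v) \<le> card {v}"
      by (rule card_mono) (use 2 Suc.prems superseqs_len_length_snd[of v u] in auto)
    then show ?thesis using 2 by simp
  next
    case 3
    then obtain a' b' where ab: "a = Suc a'" "b = Suc b'" by (meson gr0_implies_Suc)
    show ?thesis
    proof (cases "u = [] \<or> v = []")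
      case True
      \<comment> \<open>If one word is empty, the other is itself a common supersequence, too short
        since \<open>a\<close> and \<open>b\<close> are positive.\<close>
      then have "Suc k \<le> length u \<or> Suc k \<le> length v"
        using Suc.prems(3)[of u] Suc.prems(3)[of v] by auto
      then show ?thesis using 3 Suc.prems by auto
    next
      case False
      then obtain x u' y v' where uv: "u = x # u'" "v = y # v'" by (meson neq_Nil_conv)
      \<comment> \<open>A first letter other than \<open>x\<close> and \<open>y\<close> could be
        deleted, leaving a common supersequence below the bound.\<close>
      have shape: "\<exists>w'. (w = x # w' \<or> w = y # w') \<and> length w' = k"
        if w: "w \<in> superseqs_len (Suc k) u v" for w
      proof -
        obtain z w' where z: "w = z # w'" "length w' = k"
          using w by (cases w) (auto simp: superseqs_len_def)
        have "z = x \<or> z = y"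
        proof (rule ccontr)
          assume "\<not> (z = x \<or> z = y)"
          then have "subseq u w'" "subseq v w'" using w uv z by (auto simp: superseqs_len_def)
          then show False using Suc.prems(3)[of w'] z by simp
        qed
        then show ?thesis using z by blast
      qed
      show ?thesis
      proof (cases "x = y")
        case True
        have sub: "superseqs_len (Suc k) u v \<subseteq> Cons x ` superseqs_len k u' v'"
        proof
          fix w assume w: "w \<in> superseqs_len (Suc k) u v"
          from shape[OF w] True obtain w' where "w = x # w'" "length w' = k" by auto
          then show "w \<in> Cons x ` superseqs_len k u' v'"
            using w uv True by (auto simp: superseqs_len_def)
        qed
        have IH: "card (superseqs_len k u' v') \<le> (a + b) choose a"
        proof (rule Suc.IH)
          fix w assume "subseq u' w" "subseq v' w"
          then show "k \<le> length w" using Suc.prems(3)[of "x # w"] uv True by auto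
        qed (use Suc.prems uv in auto)
        show ?thesis
        \<comment> \<open>The letter type is arbitrary here. If the smaller set were infinite, so
          would be the larger one by injectivity of \<open>Cons x\<close>, and its
          \<open>card\<close> would be 0.\<close>
        proof (cases "finite (superseqs_len k u' v')")
          case True
          then show ?thesis using surj_card_le[OF _ sub] IH by linarith
        next
          case False
          have "superseqs_len (Suc k) u v \<supseteq> Cons x ` superseqs_len k u' v'"
            using uv \<open>x = y\<close> by (auto simp: superseqs_len_def)
          then have "infinite (superseqs_len (Suc k) u v)"
            using False by (meson finite_imageD finite_subset inj_on_Cons1)
          then show ?thesis by simp
        qed
      next
        case False
        have eq: "superseqs_len (Suc k) u v
          = Cons x ` superseqs_len k u' v \<union> Cons y ` superseqs_len k u v'"
        proof (intro equalityI subsetI)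
          fix w assume w: "w \<in> superseqs_len (Suc k) u v"
          from shape[OF w] obtain w' where "w = x # w' \<or> w = y # w'" "length w' = k" by auto
          then show "w \<in> Cons x ` superseqs_len k u' v \<union> Cons y ` superseqs_len k u v'"
            using w uv False by (auto simp: superseqs_len_def)
        next
          fix w assume "w \<in> Cons x ` superseqs_len k u' v \<union> Cons y ` superseqs_len k u v'"
          then show "w \<in> superseqs_len (Suc k) u v"
            using uv False by (auto simp: superseqs_len_def)
        qed
        \<comment> \<open>\<open>u'\<close> and the target length both drop by one, so
          \<open>a\<close> stays; \<open>v\<close> keeps its length, so its deficit drops to
          \<open>b'\<close>. In \<open>IH2\<close> the roles are exchanged, and Pascal's rule adds
          the two bounds.\<close>
        have IH1: "card (superseqs_len k u' v) \<le> (a + b') choose a"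
        proof (rule Suc.IH)
          fix w assume "subseq u' w" "subseq v w"
          then show "k \<le> length w"
            using Suc.prems(3)[of "x # w"] uv(1) list_emb_Cons by fastforce
        qed (use Suc.prems uv ab in auto)
        have IH2: "card (superseqs_len k u v') \<le> (a' + b) choose a'"
        proof (rule Suc.IH)
          fix w assume "subseq u w" "subseq v' w"
          then show "k \<le> length w"
            using Suc.prems(3)[of "y # w"] uv(2) list_emb_Cons by fastforce
        qed (use Suc.prems uv ab in auto)
        have "card (superseqs_len (Suc k) u v)
          \<le> card (Cons x ` superseqs_len k u' v) + card (Cons y ` superseqs_len k u v')"
          unfolding eq by (rule card_Un_le)
        also have "\<dots> = card (superseqs_len k u' v) + card (superseqs_len k u v')"
          by (simp add: card_image)
        also have "\<dots> \<le> (a + b) choose a"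
          using IH1 IH2 ab by simp
        finally show ?thesis .
      qed
    qed
  qed
qed

section \<open>Comparing the two counts\<close>

text \<open>The sum condition ties \<open>k\<close> to \<open>l\<close> through the recursion: equal
  first letters lower both by one, different ones lower only \<open>k\<close>. The finite alphabet
  makes \<open>card\<close> monotone on the supersequence side.\<close>

lemma card_subseqs_len_le_superseqs_len:
  fixes u v :: "'a::finite list"
  assumes "k + l = length u + length v"
    and "\<And>w. subseq w u \<Longrightarrow> subseq w v \<Longrightarrow> length w \<le> l"
  shows "card (subseqs_len l u v) \<le> card (superseqs_len k u v)"
  using assms
proof (induction k arbitrary: u v l)
  case 0
  show ?case
  proof (cases "subseqs_len l u v = {}")
    case False
    then obtain w where "subseq w u" "subseq w v" "length w = l" by (auto simp: subseqs_len_def)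
    \<comment> \<open>\<open>w\<close> has length \<open>length u + length v\<close> but fits into
      each word.\<close>
    then have "u = []" "v = []" using 0 by (auto dest!: list_emb_length)
    then have "subseqs_len l u v \<subseteq> superseqs_len 0 u v"
      using 0 by (auto simp: subseqs_len_def superseqs_len_def)
    then show ?thesis by (rule card_mono[OF finite_superseqs_len])
  qed simp
next
  case (Suc k)
  show ?case
  proof (cases "u = [] \<or> v = []")
    case True
    show ?thesis
    \<comment> \<open>With \<open>l = 0\<close> the empty word is the only candidate, matched by
      \<open>u @ v\<close>; for positive \<open>l\<close> nothing embeds into the empty
      word.\<close>
    proof (cases "l = 0")
      case True
      then have "u @ v \<in> superseqs_len (Suc k) u v"
        using Suc.prems \<open>u = [] \<or> v = []\<close> by (auto simp: superseqs_len_def)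
      then have "card {u @ v} \<le> card (superseqs_len (Suc k) u v)"
        by (intro card_mono finite_superseqs_len) auto
      moreover have "card (subseqs_len l u v) \<le> card {[] :: 'a list}"
        by (rule card_mono) (use True in \<open>auto simp: subseqs_len_def\<close>)
      ultimately show ?thesis by simp
    next
      case False
      then have "subseqs_len l u v = {}" using \<open>u = [] \<or> v = []\<close> by (auto simp: subseqs_len_def)
      then show ?thesis by simp
    qed
  next
    case False
    then obtain x u' y v' where uv: "u = x # u'" "v = y # v'" by (meson neq_Nil_conv)
    show ?thesis
    proof (cases "x = y")
      case True
      have "l \<noteq> 0" using Suc.prems(2)[of "[x]"] uv True by auto
      then obtain l' where l: "l = Suc l'" using not0_implies_Suc by blast
      have "subseqs_len l u v \<subseteq> Cons x ` subseqs_len l' u' v'"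
      proof
        fix w assume w: "w \<in> subseqs_len l u v"
        then obtain z w' where z: "w = z # w'" "length w' = l'"
          by (cases w) (auto simp: subseqs_len_def l)
        \<comment> \<open>Otherwise \<open>w\<close> embeds into both tails, and prepending
          \<open>x\<close> would exceed the bound \<open>l\<close>.\<close>
        have "z = x"
        proof (rule ccontr)
          assume "z \<noteq> x"
          then have "subseq (x # w) u" "subseq (x # w) v"
            using w uv True z by (auto simp: subseqs_len_def)
          then show False using Suc.prems(2)[of "x # w"] z l by simp
        qed
        then show "w \<in> Cons x ` subseqs_len l' u' v'"
          using w uv True z by (auto simp: subseqs_len_def)
      qed
      then have "card (subseqs_len l u v) \<le> card (subseqs_len l' u' v')"
        by (rule surj_card_le[OF finite_subseqs_len])
      also have "\<dots> \<le> card (superseqs_len k u' v')"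
      proof (rule Suc.IH)
        fix w assume "subseq w u'" "subseq w v'"
        then show "length w \<le> l'" using Suc.prems(2)[of "x # w"] uv True l by auto
      qed (use Suc.prems uv l in auto)
      also have "\<dots> = card (Cons x ` superseqs_len k u' v')" by (simp add: card_image)
      also have "\<dots> \<le> card (superseqs_len (Suc k) u v)"
        by (rule card_mono[OF finite_superseqs_len]) (use uv True in \<open>auto simp: superseqs_len_def\<close>)
      finally show ?thesis .
    next
      case False
      have "subseqs_len l u v \<subseteq> subseqs_len l u' v \<union> subseqs_len l u v'"
      proof
        fix w assume "w \<in> subseqs_len l u v"
        then show "w \<in> subseqs_len l u' v \<union> subseqs_len l u v'"
          using uv False by (cases w) (auto simp: subseqs_len_def split: if_splits)
      qed
      then have "card (subseqs_len l u v) \<le> card (subseqs_len l u' v \<union> subseqs_len l u v')"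
        by (intro card_mono) (auto simp: finite_subseqs_len)
      also have "\<dots> \<le> card (subseqs_len l u' v) + card (subseqs_len l u v')"
        by (rule card_Un_le)
      also have "\<dots> \<le> card (superseqs_len k u' v) + card (superseqs_len k u v')"
      proof (intro add_mono Suc.IH)
        fix w assume "subseq w u'" "subseq w v"
        then show "length w \<le> l" using Suc.prems(2)[of w] uv by auto
      next
        fix w assume "subseq w u" "subseq w v'"
        then show "length w \<le> l" using Suc.prems(2)[of w] uv by auto
      qed (use Suc.prems uv in auto)
      also have "\<dots> = card (Cons x ` superseqs_len k u' v) + card (Cons y ` superseqs_len k u v')"
        by (simp add: card_image)
      \<comment> \<open>The subsequence sets may overlap, which only helps an upper bound; here the
        sizes must add exactly, and the distinct first letters \<open>x\<close> and \<open>y\<close>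
        ensure it.\<close>
      also have "\<dots> = card (Cons x ` superseqs_len k u' v \<union> Cons y ` superseqs_len k u v')"
        by (rule card_Un_disjoint[symmetric]) (use False in \<open>auto simp: finite_superseqs_len\<close>)
      also have "\<dots> \<le> card (superseqs_len (Suc k) u v)"
        by (rule card_mono[OF finite_superseqs_len])
          (use uv False in \<open>auto simp: superseqs_len_def\<close>)
      finally show ?thesis .
    qed
  qed
qed

section \<open>Specialization to optimal lengths\<close>

lemma m_LCS_eq_card: "m_LCS u v = card (subseqs_len (LCS u v) u v)"
  by (simp add: m_LCS_def subseqs_len_def common_subseqs_def conj_assoc)

lemma m_SCS_eq_card: "m_SCS u v = card (superseqs_len (SCS u v) u v)"
  by (simp add: m_SCS_def superseqs_len_def common_superseqs_def conj_assoc)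

theorem theorem1p3:
  fixes n a b :: nat and u v :: word
  assumes "n \<ge> a + b"
    and "length u = n - a"
    and "length v = n - b"
  shows "(SCS u v = n \<longleftrightarrow> LCS u v = n - a - b) \<and>
    (SCS u v = n \<longrightarrow> m_LCS u v \<le> m_SCS u v \<and> m_SCS u v \<le> (a + b) choose a)"
proof (intro conjI impI)
  \<comment> \<open>As \<open>n \<ge> a + b\<close>, the truncated subtractions are exact and the
    two optima sum to \<open>2 * n - a - b\<close>.\<close>
  show "SCS u v = n \<longleftrightarrow> LCS u v = n - a - b"
    using SCS_plus_LCS[of u v] assms by linarith
  show "m_LCS u v \<le> m_SCS u v"
    unfolding m_LCS_eq_card m_SCS_eq_card
    by (intro card_subseqs_len_le_superseqs_len SCS_plus_LCS length_le_LCS)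
  assume "SCS u v = n"
  then show "m_SCS u v \<le> (a + b) choose a"
    unfolding m_SCS_eq_card
    by (intro card_superseqs_len_le) (use assms SCS_le_length[of u _ v] in auto)
qed

end
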